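(* Let $d \ge 0$ be an integer. The Lusternik-Schnirelman-Borsuk (LSB) theorem for $S^d$ implies the Knaster-Kuratowski-Mazurkiewicz (KKM) lemma for $\Delta^d$. That is, suppose that the following statement holds: (LSB) whenever $S^d$ is covered by $d+1$ closed sets $A_1,\dots,A_{d+1}$, some $A_i$ contains a pair of antipodes, i.e. there are an index $i$ and a point $x \in S^d$ with $x \in A_i$ and $-x \in A_i$. Then the following statement holds: (KKM) whenever $\Delta^d$ is covered by $d+1$ closed sets $C_1,\dots,C_{d+1}$ such that every $x=(x_1,\dots,x_{d+1}) \in \Delta^d$ satisfies $x \in \bigcup \{ C_i : x_i > 0\}$, the intersection $\bigcap_{i=1}^{d+1} C_i$ is non-empty.
   Context: $S^d = \{x \in \mathbb{R}^{d+1} : \|x\|_2 = 1\}$ is the unit Euclidean $d$-sphere. A pair of antipodes in $S^d$ is a pair of points of the form $x, -x$ with $x \in S^d$. $\Delta^d = \{(x_1,\dots,x_{d+1}) \in \mathbb{R}^{d+1} : \sum_i x_i = 1,\ x_i \ge 0 \text{ for all } i\}$ is the standard $d$-simplex, the convex hull of the standard unit vectors of $\mathbb{R}^{d+1}$. The sets $A_i$ are closed subsets of $S^d$ and the sets $C_i$ are closed subsets of $\Delta^d$. *)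

theory Defs
  imports "HOL-Analysis.Analysis"
begin

text \<open>
  Euclidean space of dimension \<open>d + 1\<close> is \<open>real ^ 'n\<close> with \<open>CARD('n) = d + 1\<close>; its norm
  is the 2-norm, so the unit \<open>d\<close>-sphere is \<open>sphere 0 1\<close>.  The type \<open>'n\<close> replaces
  the index set \<open>{1, ..., d + 1}\<close>, both for coordinates and for the members of a cover.
\<close>

definition std_simplex :: "(real ^ 'n::finite) set"
  where "std_simplex = {x. (\<Sum>i\<in>UNIV. x $ i) = 1 \<and> (\<forall>i. x $ i \<ge> 0)}"

end

(*
  Let n = d + 1.  Put x = |y| / |y|_1 for y in the sphere (absolute values taken coordinatewise),
  r_i = dist(x, C_i) and S = r_1 + ... + r_n.  The functions h_i(y) = y_i max(0, S - n r_i) are odd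
  and continuous, so by LSB in its Borsuk-Ulam form they all take the same value at some y.  Some
  r_j is at least the average S / n, which makes h_j(y) and hence every h_i(y) equal to 0.  But x lies in some C_i
  with x_i > 0, and there h_i(y) = y_i S.  Hence S = 0, i.e. x lies in every C_i.
*)
theory Submission
  imports Defs
begin

text \<open>Fixing an index \<open>a\<close>, the differences \<open>f i\<close> of
  \<open>h i\<close> and \<open>h a\<close> are odd and \<open>f a\<close> vanishes, so the claim
  asks for a common zero of the others, as in Borsuk-Ulam. Without one, sorting points by which
  \<open>f i\<close> is large and positive yields a closed cover of the sphere in which no member
  contains antipodes.\<close>

lemma LSB_odd_functions_agree:
  fixes h :: "'n::finite \<Rightarrow> real ^ 'n \<Rightarrow> real"
  assumes LSB: "\<forall>A :: 'n \<Rightarrow> (real ^ 'n) set.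
        (\<forall>i. closed (A i) \<and> A i \<subseteq> sphere 0 1) \<and> (\<Union>i. A i) = sphere 0 1
        \<longrightarrow> (\<exists>i. \<exists>x \<in> sphere 0 1. x \<in> A i \<and> - x \<in> A i)"
    and cont: "\<And>i. continuous_on (sphere 0 1) (h i)"
    and odd: "\<And>i y. h i (- y) = - h i y"
  obtains y where "y \<in> sphere 0 1" "\<And>i j. h i y = h j y"
proof (rule ccontr)
  assume contra: "\<not> thesis"
  note agree = that
  have disagree: "\<exists>i j. h i y \<noteq> h j y" if "y \<in> sphere 0 1" for y
  proof (rule ccontr)
    assume "\<not> ?thesis"
    then show False using agree[OF that] contra by metis
  qed
  fix a :: 'n
  define f where "f i y = h i y - h a y" for i y
  define T where "T y = (\<Sum>i\<in>UNIV. \<bar>f i y\<bar>)" for y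
  \<comment> \<open>The threshold is half the average of the \<open>\<bar>f i y\<bar>\<close>: even
    in \<open>y\<close>, positive off the common zeros, and too small to bound all of them.\<close>
  define \<delta> where "\<delta> y = T y / (2 * real CARD('n))" for y
  have contf: "continuous_on (sphere 0 1) (f i)" for i
    unfolding f_def by (intro continuous_intros cont)
  have cont\<delta>: "continuous_on (sphere 0 1) \<delta>"
    unfolding \<delta>_def T_def by (intro continuous_intros contf) auto
  have oddf: "f i (- y) = - f i y" for i y
    by (simp add: f_def odd)
  have even\<delta>: "\<delta> (- y) = \<delta> y" for y
    by (simp add: \<delta>_def T_def oddf)
  have Tpos: "T y > 0" if "y \<in> sphere 0 1" for y
  proof (rule ccontr)
    assume "\<not> T y > 0"
    then have "T y = 0"
      unfolding T_def by (meson abs_ge_zero not_less order_antisym sum_nonneg)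
    then have "\<bar>f i y\<bar> = 0" for i
      unfolding T_def by (subst (asm) sum_nonneg_eq_0_iff) auto
    then have "h i y = h a y" for i
      using eq_iff_diff_eq_0 unfolding f_def by (metis abs_eq_0)
    then show False
      using disagree[OF that] by metis
  qed
  then have \<delta>pos: "\<delta> y > 0" if "y \<in> sphere 0 1" for y
    using that by (simp add: \<delta>_def)
  \<comment> \<open>The otherwise useless index \<open>a\<close> collects the points where no
    \<open>f j\<close> exceeds the threshold. Weak inequalities on both sides keep every member
    closed.\<close>
  define A where "A i = (if i = a then \<Inter>j. {y \<in> sphere 0 1. f j y \<le> \<delta> y}
     else {y \<in> sphere 0 1. \<delta> y \<le> f i y})" for i
  have closedA: "closed (A i)" for i
    unfolding A_def
    by (simp del: mem_sphere mem_sphere_0 add: closed_INT continuous_on_closed_Collect_le contf cont\<delta>)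
  have subA: "A i \<subseteq> sphere 0 1" for i
    by (auto simp: A_def)
  have "y \<in> (\<Union>i. A i)" if y: "y \<in> sphere 0 1" for y
  proof (cases "\<forall>j. f j y \<le> \<delta> y")
    case True
    then have "y \<in> A a" using y by (auto simp: A_def)
    then show ?thesis by blast
  next
    case False
    then obtain j where j: "\<delta> y < f j y" by (auto simp: not_le)
    \<comment> \<open>\<open>f a\<close> is identically 0, hence below the positive
      threshold.\<close>
    moreover have "j \<noteq> a" using j \<delta>pos[OF y] by (auto simp: f_def)
    ultimately have "y \<in> A j" using y by (auto simp: A_def)
    then show ?thesis by blast
  qed
  then have "(\<Union>i. A i) = sphere 0 1" using subA by blast
  then have "\<exists>i. \<exists>x \<in> sphere 0 1. x \<in> A i \<and> - x \<in> A i"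
    using LSB[rule_format, of A] closedA subA by simp
  then obtain i y where y: "y \<in> sphere 0 1" and mem: "y \<in> A i" "- y \<in> A i"
    by blast
  show False
  \<comment> \<open>Antipodes in \<open>A a\<close> would give \<open>T y \<le> T y / 2\<close>; in
    any other \<open>A i\<close> they would make both \<open>f i y\<close> and its negative
    positive.\<close>
  proof (cases "i = a")
    case True
    then have "\<bar>f j y\<bar> \<le> \<delta> y" for j
      using mem by (auto simp: A_def abs_le_iff oddf even\<delta>)
    then have "T y \<le> (\<Sum>j\<in>(UNIV :: 'n set). \<delta> y)"
      unfolding T_def by (intro sum_mono) auto
    also have "\<dots> = T y / 2" by (simp add: \<delta>_def)
    finally show False using Tpos[OF y] by simp
  next
    case False
    then show False
      using mem \<delta>pos[OF y] by (auto simp: A_def oddf even\<delta>)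
  qed
qed

theorem mainTheorem1:
  fixes d :: nat
  assumes dim: "CARD('n::finite) = d + 1"
    and LSB: "\<forall>A :: 'n \<Rightarrow> (real ^ 'n) set.
        (\<forall>i. closed (A i) \<and> A i \<subseteq> sphere 0 1) \<and> (\<Union>i. A i) = sphere 0 1
        \<longrightarrow> (\<exists>i. \<exists>x \<in> sphere 0 1. x \<in> A i \<and> - x \<in> A i)"
  shows KKM: "\<forall>C :: 'n \<Rightarrow> (real ^ 'n) set.
        (\<forall>i. closed (C i) \<and> C i \<subseteq> std_simplex) \<and> (\<Union>i. C i) = std_simplex \<and>
        (\<forall>x \<in> std_simplex. x \<in> \<Union> {C i | i. x $ i > 0})
        \<longrightarrow> (\<Inter>i. C i) \<noteq> {}"
proof (intro allI impI, elim conjE)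
  fix C :: "'n \<Rightarrow> (real ^ 'n) set"
  assume C: "\<forall>i. closed (C i) \<and> C i \<subseteq> std_simplex"
    and cover: "\<forall>x \<in> std_simplex. x \<in> \<Union> {C i | i. x $ i > 0}"
  \<comment> \<open>The vertex \<open>axis i 1\<close> has only its \<open>i\<close>-th coordinate
    positive, so it lies in \<open>C i\<close>. This matters at the end: \<open>infdist\<close> to
    the empty set is 0 by convention, so a zero distance alone would not give membership.\<close>
  have nonempty: "C i \<noteq> {}" for i
  proof -
    have "axis i 1 \<in> (std_simplex :: (real ^ 'n) set)"
      by (auto simp: std_simplex_def axis_def)
    then obtain j where "axis i 1 \<in> C j" "axis i (1::real) $ j > 0" using cover by blast
    then show ?thesis by (auto simp: axis_def split: if_splits)
  qed
  define L where "L y = (\<Sum>i\<in>UNIV. \<bar>y $ i\<bar>)" for y :: "real ^ 'n"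
  define p :: "real ^ 'n \<Rightarrow> real ^ 'n" where "p y = (\<chi> i. \<bar>y $ i\<bar> / L y)" for y
  define r where "r i y = infdist (p y) (C i)" for i y
  define S where "S y = (\<Sum>i\<in>UNIV. r i y)" for y
  define h where "h i y = y $ i * max 0 (S y - real CARD('n) * r i y)" for i y
  have Lpos: "L y > 0" if "y \<in> sphere 0 1" for y
    using norm_le_l1_cart[of y] that by (simp add: L_def)
  have "continuous_on (sphere 0 1) p"
    unfolding p_def
  proof (intro continuous_on_vec_lambda continuous_on_divide ballI)
    show "continuous_on (sphere 0 1) L"
      unfolding L_def by (intro continuous_intros)
    show "L y \<noteq> 0" if "y \<in> sphere 0 1" for y using Lpos[OF that] by simp
  qed (intro continuous_intros)
  then have contr: "continuous_on (sphere 0 1) (r i)" for i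
    unfolding r_def by (intro continuous_intros)
  then have "continuous_on (sphere 0 1) (h i)" for i
    unfolding h_def S_def by (intro continuous_intros)
  \<comment> \<open>Hence every \<open>r i\<close> and \<open>S\<close> is even, and the factor
    \<open>y $ i\<close> makes \<open>h i\<close> odd.\<close>
  moreover have "p (- y) = p y" for y
    by (simp add: p_def L_def)
  then have "h i (- y) = - h i y" for i y
    by (simp add: h_def S_def r_def)
  ultimately obtain y where y: "y \<in> sphere 0 1" and agree: "\<And>i j. h i y = h j y"
    using LSB_odd_functions_agree[OF LSB] by blast
  have rnonneg: "r i y \<ge> 0" for i by (simp add: r_def infdist_nonneg)
  have "p y \<in> std_simplex"
    using Lpos[OF y]
    by (auto simp: std_simplex_def p_def sum_divide_distrib[symmetric]) (simp add: L_def)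
  then obtain i where i: "p y \<in> C i" "p y $ i > 0" using cover by blast
  have "\<exists>j. S y - real CARD('n) * r j y \<le> 0"
  proof (rule ccontr)
    assume "\<not> ?thesis"
    \<comment> \<open>Both sums equal \<open>real CARD('n) * S y\<close>.\<close>
    then have "(\<Sum>j\<in>(UNIV :: 'n set). real CARD('n) * r j y) < (\<Sum>j\<in>(UNIV :: 'n set). S y)"
      by (intro sum_strict_mono) (auto simp: not_le)
    then show False by (simp add: S_def sum_distrib_left[symmetric])
  qed
  then obtain j where "S y - real CARD('n) * r j y \<le> 0" ..
  then have "h j y = 0" by (simp add: h_def max_absorb1)
  then have "h i y = 0" using agree by metis
  moreover have "r i y = 0" using i by (simp add: r_def)
  moreover have "y $ i \<noteq> 0" using i by (auto simp: p_def)
  ultimately have "S y \<le> 0" by (auto simp: h_def max_def split: if_splits)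
  then have "S y = 0" using sum_nonneg[of UNIV "\<lambda>i. r i y"] rnonneg by (simp add: S_def)
  then have "r k y = 0" for k
    using sum_nonneg_eq_0_iff[of UNIV "\<lambda>i. r i y"] rnonneg by (simp add: S_def)
  then have "p y \<in> C k" for k
    using in_closed_iff_infdist_zero[of "C k" "p y"] C nonempty[of k] by (simp add: r_def)
  then show "(\<Inter>i. C i) \<noteq> {}" by blast
qed

end
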